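(* Let $\tau>1$ be an integer and let $\mathbb{V}$ be a value domain with $|\mathbb{V}|=2^D>1$. The storage cost (number $n$ of objects, each holding one block) of any regular, wait-free, $\tau$-common write emulation of a single-reader single-writer register over $\mathbb{V}$ in which $\mathtt{read}$s are invisible is at least $\tau\cdot 2^D$ blocks.
   Context: **Model.** An asynchronous shared memory system consists of a finite set $O=\{o_1,\dots,o_n\}$ of objects (the shared storage) and a set $\Pi$ of processes. Each entity $e\in O\cup\Pi$ stores data $e.\mathit{data}$ and potentially infinite meta-data $e.\mathit{meta}$. An object's data is a single block from some domain $\mathbb{B}$; a process' data is an array of up to $L\ge1$ blocks from $\mathbb{B}$. The storage cost is $n$, the number of objects. Objects support atomic, instantaneous actions by processes: $o.\mathtt{update}_p$ is an arbitrary read-modify-write that possibly writes a block to $o.\mathit{data}$ and modifies $o.\mathit{meta}$, $p.\mathit{meta}$ and $p.\mathit{data}$; $o.\mathtt{get}_p$ may replace a block in $p.\mathit{data}$ with $o.\mathit{data}$ and may modify $p.\mathit{meta}$. An algorithm defines processes as deterministic state machines whose transitions are associated with actions; an action associated with a transition from the current state is called enabled. A configuration assigns states (data and meta) to all processes and objects. A run is a finite or infinite alternating sequence of configurations and actions (events), starting at an initial configuration and following the algorithm; events are invocations and responses (returns) of high-level operations and $\mathtt{get}$/$\mathtt{update}$ occurrences. Time $t$ in a run $r$ is the configuration after the $t$-th event. Each process' first action is an invocation and it has at most one pending (invoked, not returned) operation at any time. Two operations are concurrent if both are invoked before either returns. $e.\mathit{data}(r,t)$ is the set of distinct blocks in $e.\mathit{data}$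 at time $t$ in $r$ (for an object, identified with its single block). Process $p$ obtains block $b$ at time $t$ in $r$ if $b\notin p.\mathit{data}(r,t)$ and $b\in p.\mathit{data}(r,t+1)$. **Register emulation.** The algorithm emulates a register over a domain $\mathbb{V}$, $|\mathbb{V}|=2^D>1$, with high-level operations $\mathtt{read}_p$ and $\mathtt{write}(v)$, $v\in\mathbb{V}$. Each run begins with a dummy initialization operation writing the initial value and overlapping no operation. Single-writer: only one process, the writer, invokes $\mathtt{write}$s; the other $R=|\Pi|-1$ processes (readers) invoke only $\mathtt{read}$s. Single-reader means $R=1$. Whenever a $\mathtt{read}_p$ is invoked at time $t$ in $r$, $p.\mathit{data}(r,t)$ is empty. Readers never write data blocks to objects. Reads are invisible if $\mathtt{read}$s do not use $\mathtt{update}$s. Regularity: a $\mathtt{read}$ returns the value of either the last $\mathtt{write}$ that returns before the $\mathtt{read}$ is invoked or some $\mathtt{write}$ concurrent with it. Wait-freedom: every operation invoked by a process $p$ returns within a finite number of $p$'s actions (regardless of other processes). **Labels (analysis tool only, not part of the state available to the algorithm).** $\mathbb{W}_v$ is the set of $\mathtt{write}(v)$ operations invoked in runs of the algorithm. Each block $b$ in shared or local storage carries a label set $\mathit{Labels}(b)$. The $k$-th $\mathtt{update}$ event of a $\mathtt{write}$ operation $w$ tags the block it stores (if any) with the unique label $\langle w,k\rangle$, so that block's label set becomes $\{\langle w,k\rangle\}$ (each block in the shared storage pertains to a single write). When a reader $p$ obtains a block $b$ from an object $o$ at time $t$ in $r$, the block $b$ in $p.\mathit{data}(r,t+1)$ is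 tagged with $\mathit{Labels}(o.\mathit{data}(r,t))$; if at a later time $t'$ $p.\mathit{data}$ still contains $b$ and $p$ performs an action on an object $o'$ with $o'.\mathit{data}(r,t')=b$ tagged with label $\ell$, then $\ell$ is added to $\mathit{Labels}(b)$ at $p$. When all copies of $b$ are removed from $p.\mathit{data}$, its labels there are forgotten. For a $\mathtt{write}$ operation $w$, $\mathit{L\text{-}labels}_p(w,r,t)=\big(\bigcup_{b\in p.\mathit{data}(r,t)}\mathit{Labels}(b)\big)\cap(\{w\}\times\mathbb{N})$. **$\tau$-common write (common write $\tau$-disintegrated storage).** The algorithm is $\tau$-common write if whenever a return of $v\in\mathbb{V}$ by a $\mathtt{read}_p$ invocation is enabled at time $t$ in a run $r$, there is $w\in\mathbb{W}_v$ with $|\mathit{L\text{-}labels}_p(w,r,t)|\ge\tau$. *)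

theory Defs
  imports "HOL-Library.Extended_Nat" "HOL-Library.Cardinality"
begin

text \<open>
  Type parameters used throughout: \<open>'p\<close> is the set of processes, \<open>'o\<close> the set of objects,
  \<open>'l\<close> the index set of the block array of a process (so its length \<open>L \<ge> 1\<close> is the cardinality
  of \<open>'l\<close>), \<open>'m\<close> and \<open>'s\<close> the (arbitrary, possibly infinite) domains of the meta-data of
  processes and of objects, \<open>'b\<close> the block domain, and \<open>'v\<close> the value domain of the register.
\<close>


section \<open>Asynchronous shared memory\<close>

record ('l, 'm, 'b) process_state =
  p_meta :: 'm
  p_data :: "'l \<rightharpoonup> 'b"

record ('s, 'b) object_state =
  o_meta :: 's
  o_data :: 'b

record ('p, 'o, 'l, 'm, 's, 'b) configuration =
  proc :: "'p \<Rightarrow> ('l, 'm, 'b) process_state"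
  obj :: "'o \<Rightarrow> ('s, 'b) object_state"

datatype 'v operation = Read | Write 'v

datatype 'v response = Ack | Val 'v

text \<open>
  The action chosen in a process state. The function carried by a get or an update receives the
  current state of the accessed object. A get yields the array position (if any) whose content is
  replaced by the data of the object, and the new process meta-data. An update yields the block
  (if any) to be written to the object, the new object meta-data, and the new process state.
\<close>

datatype ('o, 'l, 'm, 's, 'b, 'v) action =
    Get 'o "('s, 'b) object_state \<Rightarrow> 'l option \<times> 'm"
  | Update 'o "('s, 'b) object_state \<Rightarrow> 'b option \<times> 's \<times> ('l, 'm, 'b) process_state"
  | Return "'v response" "('l, 'm, 'b) process_state"

text \<open>
  Processes are deterministic: \<open>trans\<close> gives the one action enabled in a process state while an
  operation is pending; an idle process can only be subject to an invocation.
\<close>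

record ('p, 'o, 'l, 'm, 's, 'b, 'v) algorithm =
  writer :: 'p
  init_val :: 'v
  initial :: "('p, 'o, 'l, 'm, 's, 'b) configuration set"
  on_invoke ::
    "'p \<Rightarrow> 'v operation \<Rightarrow> ('l, 'm, 'b) process_state \<Rightarrow> ('l, 'm, 'b) process_state"
  trans :: "'p \<Rightarrow> ('l, 'm, 'b) process_state \<Rightarrow> ('o, 'l, 'm, 's, 'b, 'v) action"

definition readers :: "('p, 'o, 'l, 'm, 's, 'b, 'v) algorithm \<Rightarrow> 'p set" where
  "readers A = UNIV - {writer A}"

definition single_reader :: "('p, 'o, 'l, 'm, 's, 'b, 'v) algorithm \<Rightarrow> bool" where
  "single_reader A \<longleftrightarrow> card (readers A) = 1"

definition storage_cost :: "('p, 'o::finite, 'l, 'm, 's, 'b, 'v) algorithm \<Rightarrow> nat" where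
  "storage_cost A = CARD('o)"

text \<open>The last argument of \<open>Ev_Update\<close> is the block stored in the object, if any.\<close>

datatype ('p, 'o, 'b, 'v) event =
    Ev_Invoke 'p "'v operation"
  | Ev_Return 'p "'v response"
  | Ev_Get 'p 'o
  | Ev_Update 'p 'o "'b option"

fun actor :: "('p, 'o, 'b, 'v) event \<Rightarrow> 'p" where
  "actor (Ev_Invoke p x) = p"
| "actor (Ev_Return p y) = p"
| "actor (Ev_Get p a) = p"
| "actor (Ev_Update p a w) = p"

fun target :: "('p, 'o, 'b, 'v) event \<Rightarrow> 'o option" where
  "target (Ev_Invoke p x) = None"
| "target (Ev_Return p y) = None"
| "target (Ev_Get p a) = Some a"
| "target (Ev_Update p a w) = Some a"

inductive step ::
    "('p, 'o, 'l, 'm, 's, 'b, 'v) algorithm \<Rightarrow> ('p, 'o, 'l, 'm, 's, 'b) configuration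
      \<Rightarrow> ('p, 'o, 'b, 'v) event \<Rightarrow> ('p, 'o, 'l, 'm, 's, 'b) configuration \<Rightarrow> bool"
  for A where
  invoke:
    "step A C (Ev_Invoke p x) (C\<lparr>proc := (proc C)(p := on_invoke A p x (proc C p))\<rparr>)"
| return:
    "trans A p (proc C p) = Return y \<sigma> \<Longrightarrow>
     step A C (Ev_Return p y) (C\<lparr>proc := (proc C)(p := \<sigma>)\<rparr>)"
| get:
    "trans A p (proc C p) = Get a f \<Longrightarrow>
     f (obj C a) = (i, m) \<Longrightarrow>
     \<sigma> = \<lparr>p_meta = m,
          p_data = (case i of
              None \<Rightarrow> p_data (proc C p)
            | Some j \<Rightarrow> (p_data (proc C p))(j \<mapsto> o_data (obj C a)))\<rparr> \<Longrightarrow>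
     step A C (Ev_Get p a) (C\<lparr>proc := (proc C)(p := \<sigma>)\<rparr>)"
| update:
    "trans A p (proc C p) = Update a f \<Longrightarrow>
     f (obj C a) = (w, s, \<sigma>) \<Longrightarrow>
     \<omega> = \<lparr>o_meta = s, o_data = (case w of None \<Rightarrow> o_data (obj C a) | Some b \<Rightarrow> b)\<rparr> \<Longrightarrow>
     step A C (Ev_Update p a w) (C\<lparr>proc := (proc C)(p := \<sigma>), obj := (obj C)(a := \<omega>)\<rparr>)"


section \<open>Runs\<close>

text \<open>
  A run with \<open>len\<close> many events (possibly \<open>\<infinity>\<close>) is the alternating sequence
  \<open>conf 0, ev 0, conf 1, ev 1, \<dots>\<close>; the entries \<open>ev t\<close> with \<open>t \<ge> len\<close> and \<open>conf t\<close> with \<open>t > len\<close>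
  are meaningless. An operation in a run is identified with the time of its invocation event.
\<close>

record ('p, 'o, 'l, 'm, 's, 'b, 'v) run =
  len :: enat
  conf :: "nat \<Rightarrow> ('p, 'o, 'l, 'm, 's, 'b) configuration"
  ev :: "nat \<Rightarrow> ('p, 'o, 'b, 'v) event"

definition p_blocks ::
    "('p, 'o, 'l, 'm, 's, 'b, 'v) run \<Rightarrow> nat \<Rightarrow> 'p \<Rightarrow> 'b set" where
  "p_blocks r t p = ran (p_data (proc (conf r t) p))"

definition o_block :: "('p, 'o, 'l, 'm, 's, 'b, 'v) run \<Rightarrow> nat \<Rightarrow> 'o \<Rightarrow> 'b" where
  "o_block r t a = o_data (obj (conf r t) a)"

text \<open>\<open>pending r t p\<close> is the operation of \<open>p\<close> that is pending at time \<open>t\<close>, if any.\<close>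

fun pending :: "('p, 'o, 'l, 'm, 's, 'b, 'v) run \<Rightarrow> nat \<Rightarrow> 'p \<Rightarrow> nat option" where
  "pending r 0 p = None"
| "pending r (Suc t) p =
    (case ev r t of
       Ev_Invoke q x \<Rightarrow> if q = p then Some t else pending r t p
     | Ev_Return q y \<Rightarrow> if q = p then None else pending r t p
     | _ \<Rightarrow> pending r t p)"

fun may_occur ::
    "('p, 'o, 'l, 'm, 's, 'b, 'v) algorithm \<Rightarrow> ('p, 'o, 'l, 'm, 's, 'b, 'v) run
      \<Rightarrow> nat \<Rightarrow> ('p, 'o, 'b, 'v) event \<Rightarrow> bool" where
  "may_occur A r t (Ev_Invoke p x) \<longleftrightarrow>
     pending r t p = None \<and> (if p = writer A then x \<noteq> Read else x = Read)"
| "may_occur A r t e \<longleftrightarrow> pending r t (actor e) \<noteq> None"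

text \<open>
  The last two conditions say that the run starts with the dummy write of the initial value
  (operation \<open>0\<close>) and that nothing else is invoked before that operation has returned.
\<close>

definition is_run ::
    "('p, 'o, 'l, 'm, 's, 'b, 'v) algorithm \<Rightarrow> ('p, 'o, 'l, 'm, 's, 'b, 'v) run \<Rightarrow> bool" where
  "is_run A r \<longleftrightarrow>
     conf r 0 \<in> initial A \<and>
     (\<forall>t. enat t < len r \<longrightarrow>
        step A (conf r t) (ev r t) (conf r (Suc t)) \<and> may_occur A r t (ev r t)) \<and>
     (enat 0 < len r \<longrightarrow> ev r 0 = Ev_Invoke (writer A) (Write (init_val A))) \<and>
     (\<forall>t p x. enat t < len r \<longrightarrow> ev r t = Ev_Invoke p x \<longrightarrow> pending r t (writer A) \<noteq> Some 0)"

definition writes_of ::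
    "('p, 'o, 'l, 'm, 's, 'b, 'v) algorithm \<Rightarrow> ('p, 'o, 'l, 'm, 's, 'b, 'v) run
      \<Rightarrow> 'v \<Rightarrow> nat set" where
  "writes_of A r v = {w. enat w < len r \<and> ev r w = Ev_Invoke (writer A) (Write v)}"

definition returns_at :: "('p, 'o, 'l, 'm, 's, 'b, 'v) run \<Rightarrow> nat \<Rightarrow> nat \<Rightarrow> bool" where
  "returns_at r q t \<longleftrightarrow>
     enat t < len r \<and> (\<exists>p y. ev r t = Ev_Return p y \<and> pending r t p = Some q)"

definition concurrent :: "('p, 'o, 'l, 'm, 's, 'b, 'v) run \<Rightarrow> nat \<Rightarrow> nat \<Rightarrow> bool" where
  "concurrent r q q' \<longleftrightarrow>
     (\<forall>t. returns_at r q t \<longrightarrow> q' < t) \<and> (\<forall>t. returns_at r q' t \<longrightarrow> q < t)"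

definition last_write_before ::
    "('p, 'o, 'l, 'm, 's, 'b, 'v) algorithm \<Rightarrow> ('p, 'o, 'l, 'm, 's, 'b, 'v) run
      \<Rightarrow> nat \<Rightarrow> nat \<Rightarrow> bool" where
  "last_write_before A r q w \<longleftrightarrow>
     (\<exists>t<q. returns_at r w t \<and> (\<exists>v. w \<in> writes_of A r v) \<and>
        (\<forall>w' v' t'. w' \<in> writes_of A r v' \<longrightarrow> returns_at r w' t' \<longrightarrow> t' < q \<longrightarrow> t' \<le> t))"


section \<open>Register emulations\<close>

definition register_emulation :: "('p, 'o, 'l, 'm, 's, 'b, 'v) algorithm \<Rightarrow> bool" where
  "register_emulation A \<longleftrightarrow>
     initial A \<noteq> {} \<and>
     (\<forall>r t p. is_run A r \<longrightarrow> enat t < len r \<longrightarrow> ev r t = Ev_Invoke p Read \<longrightarrow> p_blocks r t p = {}) \<and>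
     (\<forall>r t p a b. is_run A r \<longrightarrow> enat t < len r \<longrightarrow> ev r t = Ev_Update p a (Some b) \<longrightarrow>
        p \<notin> readers A)"

definition invisible_reads :: "('p, 'o, 'l, 'm, 's, 'b, 'v) algorithm \<Rightarrow> bool" where
  "invisible_reads A \<longleftrightarrow>
     (\<forall>r t p a w. is_run A r \<longrightarrow> enat t < len r \<longrightarrow> ev r t = Ev_Update p a w \<longrightarrow> p \<notin> readers A)"

definition regular :: "('p, 'o, 'l, 'm, 's, 'b, 'v) algorithm \<Rightarrow> bool" where
  "regular A \<longleftrightarrow>
     (\<forall>r p q t y. is_run A r \<longrightarrow> enat t < len r \<longrightarrow>
        ev r q = Ev_Invoke p Read \<longrightarrow> pending r t p = Some q \<longrightarrow> ev r t = Ev_Return p y \<longrightarrow>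
        (\<exists>w v. w \<in> writes_of A r v \<and> y = Val v \<and>
           (last_write_before A r q w \<or> concurrent r w q)))"

text \<open>
  A process with a pending operation always has an enabled action, so wait-freedom amounts to the
  absence of operations that do not return although their process takes infinitely many actions.
\<close>

definition wait_free :: "('p, 'o, 'l, 'm, 's, 'b, 'v) algorithm \<Rightarrow> bool" where
  "wait_free A \<longleftrightarrow>
     (\<forall>r p q x. is_run A r \<longrightarrow> enat q < len r \<longrightarrow> ev r q = Ev_Invoke p x \<longrightarrow>
        infinite {t. enat t < len r \<and> actor (ev r t) = p} \<longrightarrow>
        (\<exists>t. returns_at r q t))"


section \<open>Labels\<close>

text \<open>
  The label \<open>(w, k)\<close> marks the block stored by the \<open>k\<close>-th update of the operation \<open>w\<close>. As a
  process has at most one pending operation, the updates of \<open>w\<close> up to time \<open>t\<close>, while \<open>w\<close> is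
  pending, are the updates by its process between the times \<open>w\<close> and \<open>t\<close>.
\<close>

type_synonym label = "nat \<times> nat"

definition update_count :: "('p, 'o, 'l, 'm, 's, 'b, 'v) run \<Rightarrow> 'p \<Rightarrow> nat \<Rightarrow> nat \<Rightarrow> nat" where
  "update_count r p w t = card {u. w \<le> u \<and> u \<le> t \<and> (\<exists>a x. ev r u = Ev_Update p a x)}"

fun o_labels :: "('p, 'o, 'l, 'm, 's, 'b, 'v) run \<Rightarrow> nat \<Rightarrow> 'o \<Rightarrow> label set" where
  "o_labels r 0 a = {}"
| "o_labels r (Suc t) a =
    (case ev r t of
       Ev_Update p a' (Some b) \<Rightarrow>
         if a' = a then {(w, update_count r p w t) |w. pending r t p = Some w}
         else o_labels r t a
     | _ \<Rightarrow> o_labels r t a)"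

text \<open>
  \<open>p_labels r t p b\<close> is the label set of the block \<open>b\<close> at the reader \<open>p\<close>. It is empty as long as
  \<open>b\<close> is not in the array of \<open>p\<close>; so the second equation covers both the labelling of a newly
  obtained block and the addition of labels to a block that \<open>p\<close> already holds.
\<close>

fun p_labels :: "('p, 'o, 'l, 'm, 's, 'b, 'v) run \<Rightarrow> nat \<Rightarrow> 'p \<Rightarrow> 'b \<Rightarrow> label set" where
  "p_labels r 0 p b = {}"
| "p_labels r (Suc t) p b =
    (if b \<in> p_blocks r (Suc t) p
     then p_labels r t p b \<union>
       \<Union> {o_labels r t a |a. actor (ev r t) = p \<and> target (ev r t) = Some a \<and> o_block r t a = b}
     else {})"

definition L_labels ::
    "('p, 'o, 'l, 'm, 's, 'b, 'v) run \<Rightarrow> nat \<Rightarrow> 'p \<Rightarrow> nat \<Rightarrow> label set" where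
  "L_labels r t p w = (\<Union>b\<in>p_blocks r t p. p_labels r t p b) \<inter> ({w} \<times> UNIV)"

definition common_write ::
    "nat \<Rightarrow> ('p, 'o, 'l, 'm, 's, 'b, 'v) algorithm \<Rightarrow> bool" where
  "common_write \<tau> A \<longleftrightarrow>
     (\<forall>r t p v \<sigma>. is_run A r \<longrightarrow> enat t \<le> len r \<longrightarrow> p \<in> readers A \<longrightarrow> pending r t p \<noteq> None \<longrightarrow>
        trans A p (proc (conf r t) p) = Return (Val v) \<sigma> \<longrightarrow>
        (\<exists>w\<in>writes_of A r v. card (L_labels r t p w) \<ge> \<tau>))"

end

theory Submission
  imports Defs
begin

text \<open>
  Suppose that there are fewer than \<open>\<tau> * 2 ^ D\<close> objects. Since every object holds a block of only one
  write, at any time there is a \<^emph>\<open>missing\<close> value, no write of which owns the blocks of \<open>\<tau>\<close> objects.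
  Let the writer run alone and write a missing value whenever it is idle. From some time on, each
  object either never changes again or is overwritten infinitely often.

  Now interleave one read with this run. As reads are invisible, they do not affect the writer, and
  we can let all objects of the second kind be overwritten by new writes between any two
  actions of the reader. Then the reader obtains at most one label (fewer than \<open>\<tau>\<close>) of any write
  invoked late. If it obtains \<open>\<tau>\<close> labels of an older write of \<open>v\<close>, these belong to objects that
  never change again, so \<open>v\<close> is never missing and hence never written again, and by regularity the
  read must not return \<open>v\<close>. So the read never returns, contradicting wait-freedom.
\<close>


section \<open>Steps and pending operations\<close>

text \<open>The functions carried by gets and updates are total, so a process never gets stuck and
  runs can be extended forever.\<close>

lemma step_enabled:
  fixes A :: "('p, 'o, 'l, 'm, 's, 'b, 'v) algorithm"
  obtains e C' where "step A C e C'" "actor e = p" "\<And>q x. e \<noteq> Ev_Invoke q x"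
proof (cases "trans A p (proc C p)")
  case (Get a f)
  obtain i m where "f (obj C a) = (i, m)" by fastforce
  from that[OF step.get[OF Get this refl]] show ?thesis by simp
next
  case (Update a f)
  obtain w s \<sigma> where "f (obj C a) = (w, s, \<sigma>)" using prod_cases3 by blast
  from that[OF step.update[OF Update this refl]] show ?thesis by simp
next
  case (Return y \<sigma>)
  from that[OF step.return[OF Return]] show ?thesis by simp
qed

text \<open>An event depends only on the objects and on its own process. Together with
  \<open>step_same_effect\<close>, this lets the writer's events be replayed beside a reader in any
  state.\<close>

lemma step_transfer:
  assumes "step A C e C'" "actor e = p" "obj D = obj C" "proc D p = proc C p"
  shows "\<exists>D'. step A D e D'"
  using assms(1)
proof (cases rule: step.cases)
  case (invoke q x)
  then show ?thesis using step.invoke[of A D q x] by auto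
next
  case (return q y \<sigma>)
  then show ?thesis using step.return[of A p D y \<sigma>] assms(2,4) by auto
next
  case (get q a f i m \<sigma>)
  then show ?thesis using step.get[of A p D a f i m] assms(2-4) by auto
next
  case (update q a f w s \<sigma> \<omega>)
  then show ?thesis using step.update[of A p D a f w s \<sigma>] assms(2-4) by auto
qed

lemma step_same_effect:
  assumes "step A C e C'" "step A D e D'" "actor e = p" "obj D = obj C" "proc D p = proc C p"
  shows "obj D' = obj C' \<and> proc D' p = proc C' p"
  using assms(1)
proof (cases rule: step.cases)
  case (invoke q x)
  with assms(2) show ?thesis
    using assms(3-5) by (cases rule: step.cases) (auto split: option.splits)
next
  case (return q y \<sigma>)
  with assms(2) show ?thesis
    using assms(3-5) by (cases rule: step.cases) (auto split: option.splits)
next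
  case (get q a f i m \<sigma>)
  with assms(2) show ?thesis
    using assms(3-5) by (cases rule: step.cases) (auto split: option.splits)
next
  case (update q a f w s \<sigma> \<omega>)
  with assms(2) show ?thesis
    using assms(3-5) by (cases rule: step.cases) (auto split: option.splits)
qed

lemma step_other_process:
  assumes "step A C e C'" "actor e \<noteq> p"
  shows "proc C' p = proc C p"
  using assms by (cases rule: step.cases) auto

lemma step_obj:
  assumes "step A C e C'" "\<And>q a w. e \<noteq> Ev_Update q a w"
  shows "obj C' = obj C"
  using assms by (cases rule: step.cases) auto

lemma pending_SomeD:
  assumes "pending r t p = Some w"
  shows "w < t" "\<exists>x. ev r w = Ev_Invoke p x" "\<And>u. w < u \<Longrightarrow> u \<le> t \<Longrightarrow> pending r u p = Some w"
proof -
  have "w < t \<and> (\<exists>x. ev r w = Ev_Invoke p x) \<and> (\<forall>u. w < u \<and> u \<le> t \<longrightarrow> pending r u p = Some w)"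
    using assms by (induction t) (auto split: event.splits if_splits simp: le_Suc_eq less_Suc_eq)
  then show "w < t" "\<exists>x. ev r w = Ev_Invoke p x"
    "\<And>u. w < u \<Longrightarrow> u \<le> t \<Longrightarrow> pending r u p = Some w" by auto
qed

lemma pending_cong:
  assumes "\<And>u. u < t \<Longrightarrow> ev r u = ev r' u"
  shows "pending r t p = pending r' t p"
  using assms by (induction t) (auto split: event.splits)

lemma pending_len [simp]: "pending (r\<lparr>len := n\<rparr>) t p = pending r t p"
  by (rule pending_cong) simp

lemma pending_or_returned:
  assumes "is_run A r" "enat t \<le> len r" "ev r w = Ev_Invoke p x" "w < t"
  shows "pending r t p = Some w \<or> (\<exists>u<t. returns_at r w u)"
  using assms(2,4)
proof (induction t)
  case (Suc t)
  have t: "enat t < len r" using Suc.prems(1) Suc_ile_eq by blast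
  show ?case
  proof (cases "w = t")
    case True
    then show ?thesis using assms(3) by simp
  next
    case False
    then have "w < t" "enat t \<le> len r" using Suc.prems(2) t by auto
    then consider "pending r t p = Some w" | "\<exists>u<t. returns_at r w u"
      using Suc.IH by blast
    then show ?thesis
    proof cases
      case 1
      then show ?thesis using t assms(1)
        by (cases "ev r t") (auto simp: is_run_def returns_at_def dest: spec[of _ t])
    qed (auto intro: less_SucI)
  qed
qed simp


section \<open>Writes owning the blocks of the objects\<close>

text \<open>A set with at most one element, empty until the object is first overwritten. Update
  numbers are dropped because objects are counted per write.\<close>

definition owners :: "('p, 'o, 'l, 'm, 's, 'b, 'v) run \<Rightarrow> nat \<Rightarrow> 'o \<Rightarrow> nat set" where
  "owners r t a = fst ` o_labels r t a"

lemma owners_0 [simp]: "owners r 0 a = {}"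
  by (simp add: owners_def)

lemma owners_Suc:
  "owners r (Suc t) a =
    (case ev r t of
       Ev_Update p a' (Some b) \<Rightarrow>
         if a' = a then set_option (pending r t p) else owners r t a
     | _ \<Rightarrow> owners r t a)"
  by (cases "ev r t") (force simp: owners_def image_iff split: option.splits)+

text \<open>Each store replaces the label set by the label of that one update. Both counting
  arguments rest on this.\<close>

lemma o_labels_subset_singleton: "\<exists>l. o_labels r t a \<subseteq> {l}"
proof (induction t)
  case (Suc t)
  have "\<exists>l. {(w, update_count r p w t) |w. pending r t p = Some w} \<subseteq> {l}" for p
    by (cases "pending r t p") auto
  then show ?case using Suc by (auto split: event.splits option.splits)
qed simp

lemma owners_unique: "w \<in> owners r t a \<Longrightarrow> w' \<in> owners r t a \<Longrightarrow> w = w'"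
  using o_labels_subset_singleton[of r t a] by (auto simp: owners_def)

lemma owners_less: "w \<in> owners r t a \<Longrightarrow> w < t"
  by (induction t)
    (auto simp: owners_Suc less_SucI split: event.splits option.splits if_splits dest: pending_SomeD(1))

lemma owners_cong:
  assumes "\<And>u. u < t \<Longrightarrow> ev r u = ev r' u"
  shows "owners r t a = owners r' t a"
  using assms
proof (induction t)
  case (Suc t)
  then have "owners r t a = owners r' t a" "ev r t = ev r' t"
    "\<And>p. pending r t p = pending r' t p" by (auto intro!: pending_cong)
  then show ?case by (simp add: owners_Suc split: event.split option.split)
qed simp

definition overwrites :: "('p, 'o, 'b, 'v) event \<Rightarrow> 'o \<Rightarrow> bool" where
  "overwrites e a \<longleftrightarrow> (\<exists>p b. e = Ev_Update p a (Some b))"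

lemma o_labels_stable:
  assumes "t \<le> t'" "\<And>u. t \<le> u \<Longrightarrow> u < t' \<Longrightarrow> \<not> overwrites (ev r u) a"
  shows "o_labels r t' a = o_labels r t a"
  using assms
proof (induction rule: dec_induct)
  case (step n)
  then have "\<not> overwrites (ev r n) a" by simp
  then have "o_labels r (Suc n) a = o_labels r n a"
    by (auto simp: overwrites_def split: event.splits option.splits)
  then show ?case using step by simp
qed simp

text \<open>Nothing is pending at \<open>N\<close>, so whatever is pending at a later overwrite was
  invoked at \<open>N\<close> or afterwards.\<close>

lemma owners_recent:
  assumes idle: "\<And>p. pending r N p = None" and "N \<le> u" "u < t" "overwrites (ev r u) a"
    and "w \<in> owners r t a"
  shows "N \<le> w"
  using assms(3,5)
proof (induction t)
  case (Suc t)
  have *: "N \<le> w" if "pending r t p = Some w" for p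
    using pending_SomeD(3)[OF that, of N] idle[of p] Suc.prems(1) assms(2) by fastforce
  show ?case
  proof (cases "overwrites (ev r t) a")
    case True
    then show ?thesis using Suc.prems * by (auto simp: overwrites_def owners_Suc)
  next
    case False
    then have "u < t" using Suc.prems(1) assms(4) less_SucE by blast
    moreover have "w \<in> owners r t a"
      using False Suc.prems(2) o_labels_stable[of t "Suc t" r a]
      by (auto simp: owners_def le_less_Suc_eq)
    ultimately show ?thesis using Suc.IH by blast
  qed
qed simp

text \<open>Forgetting labels only shrinks the sets, so the labels met in all accesses so far give
  an upper bound.\<close>

lemma p_labels_subset:
  "p_labels r t p b \<subseteq>
     \<Union> {o_labels r u a |u a. u < t \<and> actor (ev r u) = p \<and> target (ev r u) = Some a}"
proof (induction t)
  case (Suc t)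
  then have "p_labels r t p b \<subseteq> \<Union> {o_labels r u a |u a. u < Suc t \<and> actor (ev r u) = p
      \<and> target (ev r u) = Some a}"
    by (rule order_trans) (auto intro: less_SucI)
  then show ?case by (auto 0 3)
qed simp

text \<open>Prefixes of runs are written as updates of \<open>len\<close>, on which labels do not
  depend.\<close>

lemma o_labels_len [simp]: "o_labels (r\<lparr>len := n\<rparr>) t a = o_labels r t a"
proof (induction t)
  case (Suc t)
  then show ?case by (simp add: update_count_def split: event.split option.split)
qed simp

lemma p_labels_len [simp]: "p_labels (r\<lparr>len := n\<rparr>) t p b = p_labels r t p b"
  by (induction t) (simp_all add: p_blocks_def o_block_def)

lemma L_labels_len [simp]: "L_labels (r\<lparr>len := n\<rparr>) t p w = L_labels r t p w"
  by (simp add: L_labels_def p_blocks_def)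


section \<open>A run of the writer alone\<close>

text \<open>Only events before \<open>t\<close> are consulted, so the condition makes sense while a
  run is still being built.\<close>

definition missing ::
    "nat \<Rightarrow> 'p \<Rightarrow> ('p, 'o, 'l, 'm, 's, 'b, 'v) run \<Rightarrow> nat \<Rightarrow> 'v \<Rightarrow> bool" where
  "missing \<tau> p r t v \<longleftrightarrow>
     (\<forall>w<t. ev r w = Ev_Invoke p (Write v) \<longrightarrow> card {a. w \<in> owners r t a} < \<tau>)"

lemma missing_cong:
  assumes "\<And>u. u < t \<Longrightarrow> ev r u = ev r' u"
  shows "missing \<tau> p r t v \<longleftrightarrow> missing \<tau> p r' t v"
  using assms owners_cong[OF assms] by (simp add: missing_def)

text \<open>Pigeonhole: otherwise every value has a write owning \<tau> objects, and these sets of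
  objects are disjoint for different values.\<close>

lemma ex_missing:
  fixes r :: "('p, 'o::finite, 'l, 'm, 's, 'b, 'v) run"
  assumes fin: "finite (UNIV :: 'v set)" and less: "CARD('o) < \<tau> * CARD('v)"
  shows "\<exists>v. missing \<tau> p r t v"
proof (rule ccontr)
  assume "\<not> ?thesis"
  then have "\<forall>v. \<exists>w. ev r w = Ev_Invoke p (Write v) \<and> \<tau> \<le> card {a. w \<in> owners r t a}"
    by (auto simp: missing_def not_less)
  then obtain f where f: "\<And>v. ev r (f v) = Ev_Invoke p (Write v)"
    "\<And>v. \<tau> \<le> card {a. f v \<in> owners r t a}" by metis
  have inj: "v = v'" if "f v = f v'" for v v'
    by (metis f(1) that event.inject(1) operation.inject)
  have "CARD('v) * \<tau> \<le> (\<Sum>v\<in>UNIV. card {a. f v \<in> owners r t a})"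
    using sum_bounded_below[of UNIV \<tau> "\<lambda>v. card {a. f v \<in> owners r t a}"] f(2) by simp
  also have "\<dots> = card (\<Union>v. {a. f v \<in> owners r t a})"
    using fin inj by (subst card_UN_disjoint) (auto dest: owners_unique)
  also have "\<dots> \<le> CARD('o)" by (rule card_mono) auto
  finally show False using less by (simp add: mult.commute)
qed

text \<open>The value to be written depends on the past, so dependent choice runs over pairs of a
  configuration and an event history.\<close>

lemma ex_writer_run:
  fixes A :: "('p, 'o::finite, 'l, 'm, 's, 'b, 'v) algorithm"
  assumes init: "initial A \<noteq> {}"
    and fin: "finite (UNIV :: 'v set)" and less: "CARD('o) < \<tau> * CARD('v)"
  obtains R where "is_run A R" "len R = \<infinity>" "\<And>t. actor (ev R t) = writer A"
    "\<And>t v. ev R t = Ev_Invoke (writer A) (Write v) \<Longrightarrow> missing \<tau> (writer A) R t v"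
proof -
  let ?p = "writer A"
  \<comment> \<open>A mere carrier for the history: \<open>pending\<close> and
    \<open>missing\<close> look only at events.\<close>
  let ?r = "\<lambda>e. \<lparr>len = \<infinity>, conf = undefined, ev = e\<rparr>
    :: ('p, 'o, 'l, 'm, 's, 'b, 'v) run"
  define Q where "Q n s s' \<longleftrightarrow> (\<exists>x. snd s' = (snd s)(n := x) \<and> step A (fst s) x (fst s') \<and> actor x = ?p \<and>
      (if pending (?r (snd s)) n ?p = None
       then \<exists>v. x = Ev_Invoke ?p (Write v) \<and> missing \<tau> ?p (?r (snd s)) n v \<and> (n = 0 \<longrightarrow> v = init_val A)
       else \<forall>q y. x \<noteq> Ev_Invoke q y))"
    for n and s s' :: "('p, 'o, 'l, 'm, 's, 'b) configuration \<times> (nat \<Rightarrow> ('p, 'o, 'b, 'v) event)"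
  have "\<exists>s'. Q n s s'" for n s
  proof (cases "pending (?r (snd s)) n ?p = None")
    case True
    obtain v where v: "missing \<tau> ?p (?r (snd s)) n v" "n = 0 \<longrightarrow> v = init_val A"
    proof (cases "n = 0")
      case True
      \<comment> \<open>No write precedes time 0, so the prescribed initial value is vacuously
        missing.\<close>
      then show ?thesis using that[of "init_val A"] by (simp add: missing_def)
    next
      case False
      obtain v where "missing \<tau> ?p (?r (snd s)) n v" using ex_missing[OF fin less] by metis
      with False show ?thesis using that by simp
    qed
    let ?e = "Ev_Invoke ?p (Write v)"
    obtain C' where C': "step A (fst s) ?e C'" using step.invoke[of A "fst s"] by metis
    have "Q n s (C', (snd s)(n := ?e))"
      unfolding Q_def by (rule exI[of _ ?e]) (simp add: True v C')
    then show ?thesis by blast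
  next
    case False
    obtain e C' where e: "step A (fst s) e C'" "actor e = ?p" "\<And>q x. e \<noteq> Ev_Invoke q x"
      using step_enabled by metis
    have "Q n s (C', (snd s)(n := e))"
      unfolding Q_def by (rule exI[of _ e]) (simp add: False e)
    then show ?thesis by blast
  qed
  moreover obtain C0 where "C0 \<in> initial A" using init by blast
  ultimately have "\<exists>f. \<forall>n. (n = 0 \<longrightarrow> fst (f n) \<in> initial A) \<and> Q n (f n) (f (Suc n))"
    by (intro dependent_nat_choice) auto
  then obtain f where f: "fst (f 0) \<in> initial A" "\<And>n. Q n (f n) (f (Suc n))" by blast
  define R :: "('p, 'o, 'l, 'm, 's, 'b, 'v) run"
    where "R = \<lparr>len = \<infinity>, conf = \<lambda>n. fst (f n), ev = \<lambda>n. snd (f (Suc n)) n\<rparr>"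
  \<comment> \<open>Stage \<open>n\<close> changes only position \<open>n\<close>, so below
    \<open>n\<close> its history agrees with the limit run.\<close>
  have hist: "u < n \<Longrightarrow> snd (f n) u = ev R u" for n u
  proof (induction n)
    case (Suc n)
    then show ?case using f(2)[of n] by (auto simp: Q_def R_def less_Suc_eq)
  qed simp
  have pend: "pending (?r (snd (f n))) n q = pending R n q" for n q
    by (rule pending_cong) (simp add: hist)
  have miss: "missing \<tau> ?p (?r (snd (f n))) n v = missing \<tau> ?p R n v" for n v
    by (rule missing_cong) (simp add: hist)
  have Q: "Q n (conf R n, snd (f n)) (conf R (Suc n), snd (f (Suc n)))" for n
    using f(2)[of n] by (simp add: R_def)
  have evR: "snd (f (Suc n)) n = ev R n" for n by (simp add: R_def)
  have step: "step A (conf R n) (ev R n) (conf R (Suc n))"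
    and actor: "actor (ev R n) = ?p"
    and idle: "pending R n ?p = None \<Longrightarrow>
      \<exists>v. ev R n = Ev_Invoke ?p (Write v) \<and> missing \<tau> ?p R n v \<and> (n = 0 \<longrightarrow> v = init_val A)"
    and busy: "pending R n ?p \<noteq> None \<Longrightarrow> ev R n \<noteq> Ev_Invoke q y" for n q y
    using Q[of n] evR[of n] unfolding Q_def fst_conv snd_conv pend miss
    by (auto split: if_splits simp: eq_commute[of _ "ev R n"])
  show ?thesis
  proof
    show "len R = \<infinity>" by (simp add: R_def)
    show "actor (ev R t) = ?p" for t by (rule actor)
    show "missing \<tau> ?p R t v" if "ev R t = Ev_Invoke ?p (Write v)" for t v
      using idle[of t] busy[of t] that by fastforce
    show "is_run A R" unfolding is_run_def
    proof (intro conjI allI impI)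
      show "conf R 0 \<in> initial A" using f(1) by (simp add: R_def)
      show "ev R 0 = Ev_Invoke ?p (Write (init_val A))" using idle[of 0] by simp
      show "step A (conf R t) (ev R t) (conf R (Suc t))" for t by (rule step)
      show "may_occur A R t (ev R t)" for t
      proof (cases "pending R t ?p = None")
        case True
        then show ?thesis using idle[OF True] by auto
      next
        case False
        then show ?thesis using busy[OF False] actor[of t] by (cases "ev R t") auto
      qed
      show "pending R t ?p \<noteq> Some 0" if "ev R t = Ev_Invoke p x" for t p x
        using busy[of t] that by fastforce
    qed
  qed
qed


section \<open>Interleaving a single read\<close>

text \<open>\<open>0 < M 0\<close> leaves the first event to the dummy write, and
  \<open>initialized\<close> ensures that this write is over when the read is invoked.\<close>

locale interleaved_read =
  fixes A :: "('p, 'o, 'l, 'm, 's, 'b, 'v) algorithm"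
    and R :: "('p, 'o, 'l, 'm, 's, 'b, 'v) run"
    and M :: "nat \<Rightarrow> nat" and d :: 'p
  assumes run: "is_run A R" and len: "len R = \<infinity>"
    and writer_only: "\<And>t. actor (ev R t) = writer A"
    and reader: "d \<noteq> writer A"
    and M: "strict_mono M" "0 < M 0"
    and initialized: "pending R (M 0) (writer A) \<noteq> Some 0"
begin

text \<open>
  In the interleaved run, the \<open>j\<close>-th action of the reader \<open>d\<close> (its invocation for \<open>j = 0\<close>) takes
  place just before the event \<open>M j\<close> of \<open>R\<close>. The state of the schedule counts the events of \<open>R\<close> and
  the actions of \<open>d\<close> that have taken place.
\<close>

fun sched :: "nat \<Rightarrow> nat \<times> nat" where
  "sched 0 = (0, 0)"
| "sched (Suc t) = (case sched t of (i, j) \<Rightarrow> if i = M j then (i, Suc j) else (Suc i, j))"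

section \<open>Arithmetic of the schedule\<close>

definition wr :: "nat \<Rightarrow> nat" where "wr t = fst (sched t)"
definition rd :: "nat \<Rightarrow> nat" where "rd t = snd (sched t)"

definition turn :: "nat \<Rightarrow> bool" where "turn t \<longleftrightarrow> wr t = M (rd t)"

lemma wr_0 [simp]: "wr 0 = 0" and rd_0 [simp]: "rd 0 = 0"
  by (simp_all add: wr_def rd_def)

lemma wr_Suc: "wr (Suc t) = (if turn t then wr t else Suc (wr t))"
  and rd_Suc: "rd (Suc t) = (if turn t then Suc (rd t) else rd t)"
  by (simp_all add: wr_def rd_def turn_def split: prod.split)

lemma wr_mono: "s \<le> t \<Longrightarrow> wr s \<le> wr t"
  by (rule lift_Suc_mono_le) (auto simp: wr_Suc)

lemma rd_mono: "s \<le> t \<Longrightarrow> rd s \<le> rd t"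
  by (rule lift_Suc_mono_le) (auto simp: rd_Suc)

lemma wr_le_M: "wr t \<le> M (rd t)"
proof (induction t)
  case (Suc t)
  then show ?case using strict_monoD[OF M(1), of "rd t" "Suc (rd t)"]
    by (auto simp: wr_Suc rd_Suc turn_def)
qed simp

lemma before_read: "t \<le> M 0 \<Longrightarrow> wr t = t \<and> rd t = 0"
  by (induction t) (auto simp: wr_Suc rd_Suc turn_def)

lemma turn_M0: "turn (M 0)"
  by (simp add: turn_def before_read)

lemma rd_pos: "0 < rd t \<longleftrightarrow> M 0 < t"
proof
  assume "M 0 < t"
  then show "0 < rd t" using rd_mono[of "Suc (M 0)" t] turn_M0 by (auto simp: rd_Suc)
qed (metis before_read leI less_numeral_extra(3))

lemma M_le_wr: "M 0 \<le> t \<Longrightarrow> M 0 \<le> wr t"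
  using wr_mono[of "M 0" t] by (simp add: before_read)

lemma rd_strict: "turn s \<Longrightarrow> s < t \<Longrightarrow> rd s < rd t"
  using rd_mono[of "Suc s" t] by (auto simp: rd_Suc)

lemma infinite_turns: "infinite {t. turn t}"
proof -
  \<comment> \<open>Induction on the number of events of \<open>R\<close> left before the reader's
    next slot.\<close>
  have "\<exists>t\<ge>N. turn t" for N
  proof (induction "M (rd N) - wr N" arbitrary: N)
    case 0
    then show ?case using wr_le_M[of N] by (auto simp: turn_def)
  next
    case (Suc n)
    then have "\<not> turn N" by (auto simp: turn_def)
    then have "n = M (rd (Suc N)) - wr (Suc N)" using Suc(2) by (simp add: wr_Suc rd_Suc)
    from Suc(1)[OF this] show ?case using Suc_leD by blast
  qed
  then show ?thesis by (auto simp: infinite_nat_iff_unbounded_le)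
qed

section \<open>Construction of the interleaved run\<close>

definition eligible :: "nat \<Rightarrow> ('p, 'o, 'b, 'v) event \<Rightarrow> bool" where
  "eligible t e \<longleftrightarrow>
     (if \<not> turn t then e = ev R (wr t)
      else if rd t = 0 then e = Ev_Invoke d Read
      else actor e = d \<and> (\<forall>q x. e \<noteq> Ev_Invoke q x))"

text \<open>\<open>SOME\<close> keeps the recursion total even without an eligible step;
  \<open>joint_step\<close> shows that one exists whenever \<open>agree\<close> holds.\<close>

definition next_step :: "nat \<Rightarrow> ('p, 'o, 'l, 'm, 's, 'b) configuration \<Rightarrow>
    ('p, 'o, 'b, 'v) event \<times> ('p, 'o, 'l, 'm, 's, 'b) configuration" where
  "next_step t C = (SOME x. step A C (fst x) (snd x) \<and> eligible t (fst x))"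

fun config :: "nat \<Rightarrow> ('p, 'o, 'l, 'm, 's, 'b) configuration" where
  "config 0 = conf R 0"
| "config (Suc t) = snd (next_step t (config t))"

definition joint :: "('p, 'o, 'l, 'm, 's, 'b, 'v) run" where
  "joint = \<lparr>len = \<infinity>, conf = config, ev = \<lambda>t. fst (next_step t (config t))\<rparr>"

section \<open>Simulation of the writer's run\<close>

definition agree :: "nat \<Rightarrow> bool" where
  "agree t \<longleftrightarrow> obj (conf joint t) = obj (conf R (wr t)) \<and>
     proc (conf joint t) (writer A) = proc (conf R (wr t)) (writer A)"

lemma R_step: "step A (conf R i) (ev R i) (conf R (Suc i))"
  and R_may_occur: "may_occur A R i (ev R i)"
  and R_initialized: "ev R i = Ev_Invoke q x \<Longrightarrow> pending R i (writer A) \<noteq> Some 0"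
  using run len by (auto simp: is_run_def)

lemma joint_step:
  assumes "agree t"
  shows "step A (conf joint t) (ev joint t) (conf joint (Suc t))" "eligible t (ev joint t)"
proof -
  have "\<exists>e C'. step A (conf joint t) e C' \<and> eligible t e"
  proof (cases "turn t")
    case False
    then show ?thesis
      using step_transfer[OF R_step writer_only, of "conf joint t" "wr t"] assms
      by (auto simp: agree_def eligible_def)
  next
    case True
    obtain e C' where e: "step A (conf joint t) e C'" "actor e = d" "\<And>q x. e \<noteq> Ev_Invoke q x"
      using step_enabled by metis
    show ?thesis
    proof (cases "rd t = 0")
      case False
      then have "eligible t e" using True e by (simp add: eligible_def)
      then show ?thesis using e(1) by blast
    next
      case 0: True
      then have "eligible t (Ev_Invoke d Read)" using True by (simp add: eligible_def)
      then show ?thesis using step.invoke[of A "conf joint t" d Read] by blast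
    qed
  qed
  then have "\<exists>x. step A (config t) (fst x) (snd x) \<and> eligible t (fst x)"
    by (auto simp: joint_def)
  from someI_ex[OF this]
  show "step A (conf joint t) (ev joint t) (conf joint (Suc t))" "eligible t (ev joint t)"
    by (simp_all add: joint_def next_step_def)
qed

text \<open>That the reader only performs gets after its invocation is settled in
  \<open>starving_read\<close>. Until then, this hypothesis on the events before \<open>T\<close>
  keeps the interleaving faithful to \<open>R\<close>.\<close>

definition calm :: "nat \<Rightarrow> bool" where
  "calm T \<longleftrightarrow> (\<forall>t<T. turn t \<longrightarrow> 0 < rd t \<longrightarrow> (\<exists>a. ev joint t = Ev_Get d a))"

lemma calm_mono: "calm T \<Longrightarrow> t \<le> T \<Longrightarrow> calm t"
  by (auto simp: calm_def)

lemma calm_SucD: "calm (Suc T) \<Longrightarrow> calm T"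
  by (rule calm_mono) auto

lemma calm_agree: "calm T \<Longrightarrow> agree T"
proof (induction T)
  case 0
  then show ?case by (simp add: agree_def joint_def)
next
  case (Suc T)
  then have ag: "agree T" using calm_SucD by blast
  note st = joint_step[OF ag]
  show ?case
  proof (cases "turn T")
    case True
    have "actor (ev joint T) \<noteq> writer A" "\<And>q a w. ev joint T \<noteq> Ev_Update q a w"
      using True st(2) Suc.prems reader
      by (auto simp: eligible_def calm_def split: if_splits)
    then have "obj (conf joint (Suc T)) = obj (conf joint T)"
      "proc (conf joint (Suc T)) (writer A) = proc (conf joint T) (writer A)"
      using step_obj[OF st(1)] step_other_process[OF st(1)] by blast+
    then show ?thesis using True ag by (simp add: agree_def wr_Suc)
  next
    case False
    then have e: "ev joint T = ev R (wr T)" using st(2) by (simp add: eligible_def)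
    show ?thesis using False ag
      step_same_effect[OF R_step st(1)[unfolded e] writer_only] by (simp add: agree_def wr_Suc)
  qed
qed

lemmas calm_step = joint_step[OF calm_agree]

lemma ev_writer: "calm T \<Longrightarrow> \<not> turn T \<Longrightarrow> ev joint T = ev R (wr T)"
  using calm_step(2) by (simp add: eligible_def)

lemma ev_invoke: "calm T \<Longrightarrow> turn T \<Longrightarrow> rd T = 0 \<Longrightarrow> ev joint T = Ev_Invoke d Read"
  using calm_step(2)[of T] by (simp add: eligible_def)

lemma ev_get: "calm T \<Longrightarrow> turn t \<Longrightarrow> 0 < rd t \<Longrightarrow> t < T \<Longrightarrow> \<exists>a. ev joint t = Ev_Get d a"
  by (auto simp: calm_def)

lemma calm_turn:
  "calm (Suc T) \<Longrightarrow> turn T \<Longrightarrow> ev joint T = Ev_Invoke d Read \<or> (\<exists>a. ev joint T = Ev_Get d a)"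
  using ev_invoke[of T] ev_get[of "Suc T" T] calm_SucD[of T] by (cases "rd T") auto

lemma writer_turn: "calm (Suc T) \<Longrightarrow> actor (ev joint T) = writer A \<Longrightarrow> \<not> turn T"
  using calm_turn[of T] reader by auto

text \<open>Operations are named by their invocation times, which the reader's actions shift;
  \<open>wr\<close> translates them back to times of \<open>R\<close>.\<close>

lemma pending_writer:
  "calm T \<Longrightarrow> pending R (wr T) (writer A) = map_option wr (pending joint T (writer A))"
proof (induction T)
  case (Suc T)
  then have IH: "pending R (wr T) (writer A) = map_option wr (pending joint T (writer A))"
    and c: "calm T" using calm_SucD by auto
  show ?case
  proof (cases "turn T")
    case True
    then show ?thesis using calm_turn[OF Suc.prems True] IH reader by (auto simp: wr_Suc)
  next
    case False
    then show ?thesis using IH ev_writer[OF c False] writer_only[of "wr T"]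
      by (cases "ev R (wr T)") (auto simp: wr_Suc)
  qed
qed simp

lemma pending_reader: "calm T \<Longrightarrow> pending joint T d = (if T \<le> M 0 then None else Some (M 0))"
proof (induction T)
  case (Suc T)
  then have IH: "pending joint T d = (if T \<le> M 0 then None else Some (M 0))"
    and c: "calm T" using calm_SucD by auto
  show ?case
  proof (cases "turn T")
    case True
    show ?thesis
    proof (cases "rd T")
      case 0
      then have "T \<le> M 0" using rd_pos[of T] by simp
      moreover from this have "T = M 0" using True before_read[of T] by (simp add: turn_def)
      ultimately show ?thesis using ev_invoke[OF c True 0] by simp
    next
      case (Suc n)
      then show ?thesis using ev_get[OF Suc.prems True] IH rd_pos[of T] by auto
    qed
  next
    case False
    then have "T \<noteq> M 0" using turn_M0 by auto
    then show ?thesis using IH ev_writer[OF c False] writer_only[of "wr T"] reader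
      by (cases "ev R (wr T)") auto
  qed
qed simp

lemma owners_joint: "calm T \<Longrightarrow> owners R (wr T) a = wr ` owners joint T a"
proof (induction T)
  case (Suc T)
  then have IH: "owners R (wr T) a = wr ` owners joint T a"
    and c: "calm T" using calm_SucD by auto
  show ?case
  proof (cases "turn T")
    case True
    then show ?thesis using calm_turn[OF Suc.prems True] IH by (auto simp: wr_Suc owners_Suc)
  next
    case False
    have "set_option (pending R (wr T) q) = wr ` set_option (pending joint T q)"
      if "actor (ev R (wr T)) = q" for q
      using that writer_only[of "wr T"] pending_writer[OF c] by (simp add: option.set_map)
    with False show ?thesis
      using IH ev_writer[OF c False]
      by (cases "ev R (wr T)") (simp_all add: wr_Suc owners_Suc split: option.split)
  qed
qed simp

text \<open>The prefix includes event \<open>T\<close>, about which \<open>calm T\<close> says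
  nothing. So invisibility and regularity can be applied to that very event.\<close>

lemma is_run_joint:
  assumes "calm T"
  shows "is_run A (joint\<lparr>len := enat (Suc T)\<rparr>)"
  unfolding is_run_def
proof (intro conjI allI impI)
  let ?r = "joint\<lparr>len := enat (Suc T)\<rparr>"
  show "conf ?r 0 \<in> initial A"
    using run by (simp add: joint_def is_run_def)
  have "\<not> turn 0" "calm 0" using M by (auto simp: turn_def calm_def)
  then show "ev ?r 0 = Ev_Invoke (writer A) (Write (init_val A))"
    using ev_writer[of 0] run len by (simp add: is_run_def zero_enat_def)
  fix t assume "enat t < len ?r"
  then have c: "calm t" using calm_mono[OF assms, of t] by simp
  show "step A (conf ?r t) (ev ?r t) (conf ?r (Suc t))" using calm_step(1)[OF c] by simp
  have sub: "pending joint t (writer A) = Some 0 \<Longrightarrow> pending R (wr t) (writer A) = Some 0"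
    using pending_writer[OF c] by simp
  show "may_occur A ?r t (ev ?r t)"
  proof (cases "turn t")
    case False
    then show ?thesis
      using R_may_occur[of "wr t"] ev_writer[OF c False] pending_writer[OF c] writer_only[of "wr t"]
      by (cases "ev R (wr t)") auto
  next
    case True
    have "M 0 < t" if "0 < rd t" using that rd_pos by blast
    moreover have "t \<le> M 0" if "rd t = 0" using that rd_pos[of t] by simp
    ultimately show ?thesis
      using calm_step(2)[OF c] pending_reader[OF c] reader True
      by (cases "ev joint t") (auto simp: eligible_def split: if_splits)
  qed
  show "pending ?r t (writer A) \<noteq> Some 0" if "ev ?r t = Ev_Invoke q x" for q x
  proof (cases "turn t")
    case False
    then show ?thesis using that ev_writer[OF c False] R_initialized[of "wr t" q x] sub by auto
  next
    case True
    then have "rd t = 0" using calm_step(2)[OF c] that by (auto simp: eligible_def split: if_splits)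
    then have "wr t = M 0" using True by (simp add: turn_def)
    then show ?thesis using sub initialized by auto
  qed
qed

end

text \<open>
  The objects in \<open>V\<close> are overwritten between any two actions of the reader, always by writes invoked
  after the earlier one; the other objects no longer change when the read starts. So the labels that
  the reader obtains from a recent write all stem from a single action.
\<close>

locale starving_read = interleaved_read A R M d
  for A :: "('p, 'o::finite, 'l, 'm, 's, 'b, 'v) algorithm" and R M d +
  fixes \<tau> T0 i0 i1 :: nat and V :: "'o set" and v0 :: 'v
  assumes volatile: "\<And>j a w. a \<in> V \<Longrightarrow> w \<in> owners R (M (Suc j)) a \<Longrightarrow> M j \<le> w"
    and stable: "\<And>a i. a \<notin> V \<Longrightarrow> T0 \<le> i \<Longrightarrow> \<not> overwrites (ev R i) a"
    and missing_R: "\<And>i v. ev R i = Ev_Invoke (writer A) (Write v) \<Longrightarrow> missing \<tau> (writer A) R i v"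
    and recent: "T0 \<le> i0" "ev R i0 = Ev_Invoke (writer A) (Write v0)" "returns_at R i0 i1" "i1 < M 0"
    and \<tau>: "1 < \<tau>"
    and d: "d \<in> readers A"
    and invisible: "invisible_reads A"
    and regular_A: "regular A"
    and common: "common_write \<tau> A"
begin

lemma i0_less: "i0 < i1"
  using recent(3) pending_SomeD(1)[of R i1 _ i0] by (auto simp: returns_at_def)

lemma T0_less: "T0 < M 0"
  using recent(1,4) i0_less by simp

section \<open>Consequences of regularity\<close>

lemma early:
  assumes "calm T" "M 0 \<le> T" "t < M 0"
  shows "ev joint t = ev R t"
proof -
  have "\<not> turn t" using assms(3) before_read[of t] by (simp add: turn_def)
  then show ?thesis
    using ev_writer[of t] calm_mono[OF assms(1), of t] assms before_read[of t] by simp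
qed

lemma write_in_joint:
  assumes "calm T" "w < T" "ev joint w = Ev_Invoke (writer A) x"
  shows "\<not> turn w" "ev R (wr w) = Ev_Invoke (writer A) x"
proof -
  have c: "calm (Suc w)" using calm_mono[OF assms(1), of "Suc w"] assms(2) by simp
  then show "\<not> turn w" using writer_turn assms(3) by simp
  then show "ev R (wr w) = Ev_Invoke (writer A) x"
    using ev_writer[of w] calm_SucD[OF c] assms(3) by simp
qed

text \<open>The write \<open>i0\<close> starts at \<open>T0\<close> or later and returns before the
  read is invoked, so an older write is neither the last one before the read nor concurrent with
  it.\<close>

lemma returned_write_recent:
  assumes c: "calm T" and T: "M 0 < T"
    and w: "w < T" "ev joint w = Ev_Invoke (writer A) (Write v)"
    and reg: "last_write_before A (joint\<lparr>len := enat (Suc T)\<rparr>) (M 0) w \<or>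
      concurrent (joint\<lparr>len := enat (Suc T)\<rparr>) w (M 0)"
  shows "T0 \<le> wr w"
proof (rule ccontr)
  let ?r = "joint\<lparr>len := enat (Suc T)\<rparr>"
  assume neg: "\<not> T0 \<le> wr w"
  then have "w < M 0" using M_le_wr[of w] T0_less by (cases "w < M 0") auto
  then have "w < i0" using neg before_read[of w] recent(1) by auto
  have ev_eq: "ev ?r t = ev R t" if "t < M 0" for t
    using early[OF c _ that] T by simp
  have pend_eq: "pending ?r t q = pending R t q" if "t \<le> M 0" for t q
    by (rule pending_cong) (use that ev_eq in auto)
  \<comment> \<open>The writer invokes \<open>i0\<close> here, so every earlier write has
    returned.\<close>
  have idle: "pending ?r i0 (writer A) = None"
    using R_may_occur[of i0] recent(2,4) i0_less pend_eq[of i0] by simp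
  from reg show False
  proof
    assume "concurrent ?r w (M 0)"
    moreover have "\<exists>u<i0. returns_at ?r w u"
      using pending_or_returned[OF is_run_joint[OF c], of i0 w] w(2) \<open>w < i0\<close> idle
        recent(4) i0_less T by auto
    ultimately show False using i0_less recent(4) by (force simp: concurrent_def)
  next
    assume "last_write_before A ?r (M 0) w"
    then obtain t where t: "t < M 0" "returns_at ?r w t"
      and last: "\<And>w' v' t'. w' \<in> writes_of A ?r v' \<Longrightarrow> returns_at ?r w' t' \<Longrightarrow> t' < M 0 \<Longrightarrow> t' \<le> t"
      unfolding last_write_before_def by blast
    have "i0 \<in> writes_of A ?r v0"
      using ev_eq[of i0] recent(2,4) i0_less T by (simp add: writes_of_def)
    moreover have "returns_at ?r i0 i1"
      using recent(3,4) T ev_eq[of i1] pend_eq[of i1] by (simp add: returns_at_def)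
    ultimately have "i1 \<le> t" using last recent(4) by blast
    \<comment> \<open>Returning at \<open>i1\<close> or later, \<open>w\<close> would still be
      pending at \<open>i0\<close>.\<close>
    from t(2) obtain q where q: "pending ?r t q = Some w" by (auto simp: returns_at_def)
    then have "q = writer A" using pending_SomeD(2)[OF q] w(2) by auto
    then show False
      using pending_SomeD(3)[OF q, of i0] idle \<open>w < i0\<close> \<open>i1 \<le> t\<close> i0_less by simp
  qed
qed

section \<open>Labels from stable and from volatile objects\<close>

lemma owners_stable:
  assumes "a \<notin> V" "T0 \<le> i"
  shows "owners R i a = owners R T0 a"
  using o_labels_stable[OF assms(2), of R a] stable[OF assms(1)] by (simp add: owners_def)

lemma labels_stable:
  assumes "calm T" "a \<notin> V" "M 0 \<le> u" "u \<le> T"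
  shows "o_labels joint u a = o_labels joint (M 0) a"
proof (rule o_labels_stable[OF assms(3)])
  fix s assume s: "M 0 \<le> s" "s < u"
  then have c: "calm (Suc s)" using calm_mono[OF assms(1), of "Suc s"] assms(4) by simp
  show "\<not> overwrites (ev joint s) a"
  proof (cases "turn s")
    case True
    then show ?thesis using calm_turn[OF c] by (auto simp: overwrites_def)
  next
    case False
    then show ?thesis
      using ev_writer[OF calm_SucD[OF c]] stable[OF assms(2), of "wr s"] M_le_wr[OF s(1)] T0_less
      by simp
  qed
qed

definition gets :: "nat \<Rightarrow> nat \<Rightarrow> 'o \<Rightarrow> bool" where
  "gets T u a \<longleftrightarrow> u < T \<and> ev joint u = Ev_Get d a"

lemma getsD:
  assumes "calm T" "gets T u a"
  shows "turn u" "M 0 < u" "u < T" "0 < rd u"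
proof -
  have u: "u < T" "ev joint u = Ev_Get d a" using assms(2) by (auto simp: gets_def)
  have c: "calm u" using calm_mono[OF assms(1), of u] u by simp
  show "turn u"
    using ev_writer[OF c] writer_only[of "wr u"] u(2) reader by (metis actor.simps(3))
  then show "0 < rd u" using ev_invoke[OF c] u(2) by (cases "rd u") auto
  then show "M 0 < u" using rd_pos by simp
  show "u < T" by (rule u(1))
qed

lemma L_labels_gets:
  assumes c: "calm T" and "l \<in> L_labels joint T d w"
  obtains u a where "gets T u a" "l \<in> o_labels joint u a" "w \<in> owners joint u a"
proof -
  from assms(2) obtain b where "l \<in> p_labels joint T d b" and w: "fst l = w"
    by (auto simp: L_labels_def)
  then obtain u a where u: "l \<in> o_labels joint u a" "u < T" "actor (ev joint u) = d"
    "target (ev joint u) = Some a"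
    using p_labels_subset[of joint T d b] by blast
  have cs: "calm (Suc u)" using calm_mono[OF c, of "Suc u"] u(2) by simp
  have "turn u"
    using ev_writer[OF calm_SucD[OF cs]] writer_only[of "wr u"] u(3) reader by (cases "turn u") auto
  then have "ev joint u = Ev_Get d a" using calm_turn[OF cs] u(4) by auto
  then show ?thesis using that[of u a] u w by (auto simp: gets_def owners_def)
qed

text \<open>The get takes place at time \<open>M (rd u)\<close> of \<open>R\<close>, and by
  \<open>volatile\<close> the block read belongs to a write invoked since the previous slot. This
  window identifies the get.\<close>

lemma volatile_window:
  assumes c: "calm T" and g: "gets T u a" and "a \<in> V" "w \<in> owners joint u a"
  obtains j where "rd u = Suc j" "M j \<le> wr w" "wr w < M (rd u)"
proof -
  obtain j where j: "rd u = Suc j" using getsD(4)[OF c g] by (cases "rd u") auto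
  have "calm u" using calm_mono[OF c, of u] getsD[OF c g] by simp
  then have "wr w \<in> owners R (M (rd u)) a"
    using owners_joint[of u a] assms(4) getsD(1)[OF c g] by (simp add: turn_def)
  then show ?thesis using that[OF j] volatile[OF assms(3), of "wr w" j] owners_less j by metis
qed

lemma stable_owner:
  assumes c: "calm T" and g: "gets T u a" and a: "a \<notin> V" and "w \<in> owners joint u a"
  shows "wr w \<in> owners R T0 a"
proof -
  have "calm u" using calm_mono[OF c, of u] getsD[OF c g] by simp
  moreover have "T0 \<le> wr u" using M_le_wr[of u] getsD(2)[OF c g] T0_less by simp
  ultimately show ?thesis using owners_joint[of u a] owners_stable[OF a] assms(4) by blast
qed

text \<open>If some label of \<open>w\<close> comes from a volatile object, \<open>w\<close> is too
  recent to own stable ones and all its labels come from one get, which is fewer than \<tau>.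
  Otherwise all come from stable objects, each supplying at most one.\<close>

lemma enough_labels_stable:
  assumes c: "calm T" and T: "M 0 \<le> T" and \<tau>_le: "\<tau> \<le> card (L_labels joint T d w)"
  shows "\<tau> \<le> card {a. a \<notin> V \<and> wr w \<in> owners R T0 a}"
proof (cases "\<exists>u a. gets T u a \<and> a \<in> V \<and> w \<in> owners joint u a")
  case True
  then obtain u a where u: "gets T u a" "a \<in> V" "w \<in> owners joint u a" by blast
  obtain j where j: "rd u = Suc j" "M j \<le> wr w" "wr w < M (rd u)"
    using volatile_window[OF c u] .
  have "l \<in> o_labels joint u a" if l: "l \<in> L_labels joint T d w" for l
  proof -
    obtain u' a' where u': "gets T u' a'" "l \<in> o_labels joint u' a'" "w \<in> owners joint u' a'"
      using L_labels_gets[OF c l] .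
    have "a' \<in> V"
    proof (rule ccontr)
      assume "a' \<notin> V"
      from owners_less[OF stable_owner[OF c u'(1) this u'(3)]] have "wr w < T0" .
      then show False using j(2) T0_less strict_mono_less_eq[OF M(1), of 0 j] by simp
    qed
    obtain j' where j': "rd u' = Suc j'" "M j' \<le> wr w" "wr w < M (rd u')"
      using volatile_window[OF c u'(1) \<open>a' \<in> V\<close> u'(3)] .
    \<comment> \<open>Windows of different slots are disjoint and both contain \<open>wr w\<close>,
      so the two gets coincide.\<close>
    have "M j < M (Suc j')" "M j' < M (Suc j)" using j j' by auto
    then have "rd u = rd u'" using j(1) j'(1) strict_mono_less[OF M(1)] by simp
    then have "u = u'"
      using rd_strict[of u u'] rd_strict[of u' u] getsD(1)[OF c u(1)] getsD(1)[OF c u'(1)]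
      by (cases u u' rule: linorder_cases) auto
    then show ?thesis using u' u(1) by (simp add: gets_def)
  qed
  then have "L_labels joint T d w \<subseteq> o_labels joint u a" by blast
  then obtain l where "L_labels joint T d w \<subseteq> {l}"
    using o_labels_subset_singleton[of joint u a] by blast
  then have "card (L_labels joint T d w) \<le> 1" using card_mono[of "{l}"] by fastforce
  then show ?thesis using \<tau>_le \<tau> by simp
next
  case False
  let ?Y = "{a. a \<notin> V \<and> wr w \<in> owners R T0 a}"
  \<comment> \<open>All label sets are taken at the fixed time \<open>M 0\<close>, so reading an
    object repeatedly adds nothing.\<close>
  have sub: "L_labels joint T d w \<subseteq> (\<Union>a\<in>?Y. o_labels joint (M 0) a)"
  proof
    fix l assume l: "l \<in> L_labels joint T d w"
    obtain u a where u: "gets T u a" "l \<in> o_labels joint u a" "w \<in> owners joint u a"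
      using L_labels_gets[OF c l] .
    then have a: "a \<notin> V" using False by blast
    then have "o_labels joint u a = o_labels joint (M 0) a"
      using labels_stable[OF c a, of u] getsD[OF c u(1)] by simp
    then show "l \<in> (\<Union>a\<in>?Y. o_labels joint (M 0) a)"
      using u stable_owner[OF c u(1) a u(3)] a by auto
  qed
  have fin: "finite (o_labels joint (M 0) a)" and le1: "card (o_labels joint (M 0) a) \<le> 1" for a
    using o_labels_subset_singleton[of joint "M 0" a]
    by (auto dest: subset_singletonD)
  have "card (L_labels joint T d w) \<le> card (\<Union>a\<in>?Y. o_labels joint (M 0) a)"
    by (rule card_mono[OF _ sub]) (simp add: fin)
  also have "\<dots> \<le> (\<Sum>a\<in>?Y. card (o_labels joint (M 0) a))" by (rule card_UN_le) simp
  also have "\<dots> \<le> card ?Y * 1" using sum_bounded_above[of ?Y _ "1::nat"] le1 by simp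
  finally show ?thesis using \<tau>_le by simp
qed

section \<open>The read never returns\<close>

text \<open>Regularity gives a write \<open>w'\<close> of the returned value, invoked in
  \<open>R\<close> at \<open>T0\<close> or later; the common-write property gives a write
  \<open>w\<close> of it owning \<tau> stable objects. These still belong to \<open>w\<close> when
  \<open>w'\<close> is invoked, so the value was not missing then.\<close>

lemma no_return:
  assumes c: "calm T" and T: "M 0 < T"
  shows "ev joint T \<noteq> Ev_Return d y"
proof
  let ?r = "joint\<lparr>len := enat (Suc T)\<rparr>"
  assume ret: "ev joint T = Ev_Return d y"
  note run_r = is_run_joint[OF c]
  have pend: "pending ?r T d = Some (M 0)" using pending_reader[OF c] T by simp
  have "calm (M 0)" using calm_mono[OF c] T by simp
  then have inv: "ev ?r (M 0) = Ev_Invoke d Read"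
    using ev_invoke[of "M 0"] turn_M0 before_read[of "M 0"] by simp
  obtain w' v where w': "w' \<in> writes_of A ?r v" "y = Val v"
    and reg: "last_write_before A ?r (M 0) w' \<or> concurrent ?r w' (M 0)"
    using regular_A[unfolded regular_def, rule_format, OF run_r _ inv pend, of y] ret by auto
  \<comment> \<open>Event \<open>T\<close> is the return itself, so these writes lie before
    \<open>T\<close>, where \<open>calm T\<close> applies.\<close>
  have writes: "w < T" "ev joint w = Ev_Invoke (writer A) (Write v)" if "w \<in> writes_of A ?r v" for w
    using that ret by (auto simp: writes_of_def less_Suc_eq)
  note w'_R = write_in_joint[OF c writes[OF w'(1)]]
  have T0: "T0 \<le> wr w'" using returned_write_recent[OF c T writes[OF w'(1)] reg] .
  obtain \<sigma> where "trans A d (proc (conf ?r T) d) = Return (Val v) \<sigma>"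
    using calm_step(1)[OF c] w'(2) unfolding ret by (cases rule: step.cases) auto
  then obtain w where w: "w \<in> writes_of A ?r v" "\<tau> \<le> card (L_labels ?r T d w)"
    using common[unfolded common_write_def, rule_format, OF run_r, of T d v \<sigma>] d pend by auto
  note w_R = write_in_joint[OF c writes[OF w(1)]]
  let ?Y = "{a. a \<notin> V \<and> wr w \<in> owners R T0 a}"
  have "\<tau> \<le> card ?Y" using enough_labels_stable[OF c _ w(2)[simplified]] T by simp
  also have "\<dots> \<le> card {a. wr w \<in> owners R (wr w') a}"
    by (rule card_mono) (use owners_stable[OF _ T0] in auto)
  finally have le: "\<tau> \<le> card {a. wr w \<in> owners R (wr w') a}" .
  then have "{a. wr w \<in> owners R (wr w') a} \<noteq> {}" using \<tau> by (intro notI) simp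
  then have "wr w < wr w'" using owners_less[of "wr w" R "wr w'"] by auto
  then show False using missing_R[OF w'_R(2)] w_R(2) le by (auto simp: missing_def)
qed

text \<open>Calmness up to \<open>T\<close> makes the prefix a run, in which event \<open>T\<close>
  can be neither a return (\<open>no_return\<close>) nor an update of the reader
  (invisibility).\<close>

lemma calm: "calm T"
proof (induction T)
  case 0
  then show ?case by (simp add: calm_def)
next
  case (Suc T)
  have "\<exists>a. ev joint T = Ev_Get d a" if "turn T" "0 < rd T"
  proof -
    have el: "actor (ev joint T) = d" "\<And>q x. ev joint T \<noteq> Ev_Invoke q x"
      using calm_step(2)[OF Suc] that by (auto simp: eligible_def)
    have "M 0 < T" using that(2) rd_pos by simp
    note no_return[OF Suc this]
    moreover have "ev joint T \<noteq> Ev_Update d a x" for a x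
      using invisible[unfolded invisible_reads_def, rule_format, OF is_run_joint[OF Suc], of T d a x] d
      by auto
    ultimately show ?thesis using el by (cases "ev joint T") auto
  qed
  then show ?case using Suc by (auto simp: calm_def less_Suc_eq)
qed

lemma not_wait_free: "\<not> wait_free A"
proof
  assume "wait_free A"
  have run_joint: "is_run A joint"
    unfolding is_run_def
  proof (intro conjI allI impI)
    \<comment> \<open>Every condition on a run concerns a finite prefix, so it carries over from the
      truncated runs.\<close>
    note * = is_run_joint[OF calm, unfolded is_run_def]
    show "conf joint 0 \<in> initial A" using * by simp
    show "ev joint 0 = Ev_Invoke (writer A) (Write (init_val A))" using *[of 0] by (simp add: zero_enat_def)
    fix t
    show "step A (conf joint t) (ev joint t) (conf joint (Suc t))" using *[of t] by simp
    have "may_occur A (joint\<lparr>len := enat (Suc t)\<rparr>) t (ev joint t)" using *[of t] by simp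
    then show "may_occur A joint t (ev joint t)" by (cases "ev joint t") auto
    show "pending joint t (writer A) \<noteq> Some 0" if "ev joint t = Ev_Invoke p x" for p x
      using *[of t] that by simp
  qed
  have len_joint: "len joint = \<infinity>" by (simp add: joint_def)
  have inv: "ev joint (M 0) = Ev_Invoke d Read"
    using ev_invoke[OF calm] turn_M0 before_read[of "M 0"] by simp
  have "actor (ev joint t) = d" if "turn t" for t
    using calm_turn[OF calm that] by auto
  then have "infinite {t. enat t < len joint \<and> actor (ev joint t) = d}"
    using infinite_turns len_joint by (auto elim!: infinite_super[rotated])
  then obtain t where "returns_at joint (M 0) t"
    using \<open>wait_free A\<close> run_joint inv len_joint unfolding wait_free_def by force
  then obtain q y where q: "ev joint t = Ev_Return q y" "pending joint t q = Some (M 0)"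
    by (auto simp: returns_at_def)
  then have "q = d" using pending_SomeD(2)[OF q(2)] inv by auto
  then show False using no_return[OF calm] q pending_SomeD(1)[OF q(2)] by simp
qed

end


section \<open>The lower bound\<close>

theorem theorem17:
  fixes A :: "('p, 'o::finite, 'l::finite, 'm, 's, 'b, 'v) algorithm"
    and \<tau> D :: nat
  assumes "\<tau> > 1"
    and "CARD('v) = 2 ^ D" and "(2::nat) ^ D > 1"
    and "register_emulation A"
    and "single_reader A"
    and "invisible_reads A"
    and "regular A"
    and "wait_free A"
    and "common_write \<tau> A"
  shows "storage_cost A \<ge> \<tau> * 2 ^ D"
proof (rule ccontr)
  assume "\<not> ?thesis"
  then have less: "CARD('o) < \<tau> * CARD('v)" using assms(2) by (simp add: storage_cost_def)
  \<comment> \<open>An infinite type would have cardinality 0.\<close>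
  have fin: "finite (UNIV :: 'v set)" using assms(2) by (simp add: card_ge_0_finite)
  have init: "initial A \<noteq> {}" using assms(4) by (simp add: register_emulation_def)
  obtain R where run: "is_run A R" and len: "len R = \<infinity>"
    and writer_only: "\<And>t. actor (ev R t) = writer A"
    and missing_R: "\<And>t v. ev R t = Ev_Invoke (writer A) (Write v) \<Longrightarrow> missing \<tau> (writer A) R t v"
    using ex_writer_run[OF init fin less] by metis
  have may_occur: "may_occur A R t (ev R t)" for t using run len by (simp add: is_run_def)
  have other_idle: "pending R t q = None" if "q \<noteq> writer A" for t q
  proof (cases "pending R t q")
    case (Some w)
    then show ?thesis using pending_SomeD(2)[OF Some] writer_only[of w] that by auto
  qed simp
  \<comment> \<open>The writer performs all events of the infinite run, so each of its writes must
    return.\<close>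
  have returns: "\<exists>t. returns_at R w t" if "ev R w = Ev_Invoke (writer A) x" for w x
    using assms(8)[unfolded wait_free_def, rule_format, OF run _ that] len writer_only by simp
  have invocation: "\<exists>i\<ge>N. \<exists>v. ev R i = Ev_Invoke (writer A) (Write v)" for N
  proof -
    have idle: "\<exists>v. ev R i = Ev_Invoke (writer A) (Write v)" if "pending R i (writer A) = None" for i
      using may_occur[of i] writer_only[of i] that
      by (cases "ev R i"; cases "\<exists>v. ev R i = Ev_Invoke (writer A) (Write v)")
        (auto, metis operation.exhaust)
    show ?thesis
    proof (cases "pending R N (writer A)")
      case None
      then show ?thesis using idle by blast
    next
      case (Some w)
      then obtain t where "returns_at R w t" using returns pending_SomeD(2) by metis
      then obtain q y where t: "ev R t = Ev_Return q y" "pending R t q = Some w"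
        by (auto simp: returns_at_def)
      then have q: "q = writer A" using writer_only[of t] by simp
      then have idle_t: "pending R (Suc t) (writer A) = None" using t by simp
      \<comment> \<open>The operation is still pending at \<open>N\<close>, so the idle time
        \<open>Suc t\<close> comes after \<open>N\<close>.\<close>
      have "N \<le> t"
        using pending_SomeD(3)[OF Some, of "Suc t"] pending_SomeD(1)[OF t(2)] idle_t
        by (cases "N \<le> t") auto
      then show ?thesis using idle[OF idle_t] by (meson le_Suc_eq)
    qed
  qed
  define V where "V = {a. infinite {i. overwrites (ev R i) a}}"
  \<comment> \<open>Finitely many objects lie outside \<open>V\<close>, each overwritten finitely
    often.\<close>
  obtain B where B: "\<And>a i. a \<notin> V \<Longrightarrow> overwrites (ev R i) a \<Longrightarrow> i < B"
  proof -
    have "finite (\<Union>a\<in>- V. {i. overwrites (ev R i) a})" by (auto simp: V_def)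
    then obtain B where "\<forall>i\<in>(\<Union>a\<in>- V. {i. overwrites (ev R i) a}). i < B"
      using finite_nat_set_iff_bounded by blast
    then show ?thesis using that by blast
  qed
  have "\<exists>M>N. \<forall>a\<in>V. \<forall>w\<in>owners R M a. N \<le> w" for N
  proof -
    \<comment> \<open>No operation is pending when the writer invokes one. Waiting from there until
      all of \<open>V\<close> is overwritten leaves only owners invoked since.\<close>
    obtain N' v where N': "N \<le> N'" "ev R N' = Ev_Invoke (writer A) (Write v)"
      using invocation by blast
    have idle: "pending R N' q = None" for q
      using may_occur[of N'] N'(2) other_idle[of q N'] by (cases "q = writer A") auto
    have "\<forall>a\<in>V. \<exists>u\<ge>N'. overwrites (ev R u) a"
      by (auto simp: V_def infinite_nat_iff_unbounded_le)
    then obtain u where u: "\<And>a. a \<in> V \<Longrightarrow> N' \<le> u a \<and> overwrites (ev R (u a)) a" by metis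
    obtain M where M: "\<forall>x\<in>insert N (u ` V). x < M"
      using finite_nat_set_iff_bounded[of "insert N (u ` V)"] by auto
    have "N \<le> w" if "a \<in> V" "w \<in> owners R M a" for a w
      using owners_recent[OF idle, of "u a" M a w] u[OF that(1)] M that N'(1) by fastforce
    then show ?thesis using M by auto
  qed
  then obtain nx where nx: "\<And>N. N < nx N" "\<And>N a w. a \<in> V \<Longrightarrow> w \<in> owners R (nx N) a \<Longrightarrow> N \<le> w"
    by metis
  \<comment> \<open>\<open>Suc B\<close> rather than \<open>B\<close> gives \<open>0 < i0\<close>,
    so \<open>i0\<close> is not the dummy write.\<close>
  obtain i0 v0 where i0: "Suc B \<le> i0" "ev R i0 = Ev_Invoke (writer A) (Write v0)"
    using invocation by blast
  obtain i1 where i1: "returns_at R i0 i1" using returns[OF i0(2)] by blast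
  have "i0 < i1" using i1 pending_SomeD(1) by (auto simp: returns_at_def)
  \<comment> \<open>The slots start right after the return of \<open>i0\<close>; each application of
    \<open>nx\<close> leaves time to overwrite all of \<open>V\<close>.\<close>
  define M where "M j = (nx ^^ j) (Suc i1)" for j
  obtain d where d: "readers A = {d}"
    using assms(5) card_1_singletonE unfolding single_reader_def by blast
  have "pending R (Suc i1) (writer A) \<noteq> Some 0"
  proof
    assume p: "pending R (Suc i1) (writer A) = Some 0"
    \<comment> \<open>The dummy write would also be pending at \<open>i0\<close>, where the writer
      is idle.\<close>
    show False using pending_SomeD(3)[OF p, of i0] \<open>i0 < i1\<close> i0 may_occur[of i0] by simp
  qed
  moreover have "\<not> overwrites (ev R i) a" if "a \<notin> V" "Suc B \<le> i" for a i
    using B[OF that(1), of i] that(2) by auto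
  ultimately interpret starving_read A R M d \<tau> "Suc B" i0 i1 V v0
    using run len writer_only d nx i0 i1 missing_R assms(1,6,7,9)
    by unfold_locales (auto simp: M_def readers_def strict_mono_Suc_iff simp del: pending.simps)
  show False using not_wait_free assms(8) by contradiction
qed

end
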